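(* Let $t \geq 1$ and $k \geq 0$ be integers. Then $$\#\{n \in \mathbb{Z}_{>0} : n < 2^t,\ d(\alpha(n)) = k\} = \binom{t}{k+1}.$$
   Context: For a positive integer $m$, let $\omega_2(m) = \max\{a \in \mathbb{N} : 2^a \mid m\}$ and $CF_2(m) = m / 2^{\omega_2(m)}$ (the odd part of $m$). For a positive integer $n$ define $\alpha(n) = \frac{CF_2(n+1) - 1}{2}$. For a nonnegative integer $m$, $d(m)$ denotes the number of digits equal to $1$ in the binary (base $2$) expansion of $m$. *)

theory Defs
  imports Complex_Main
begin

definition omega2 :: "nat \<Rightarrow> nat" where
  "omega2 m = Max {a. 2 ^ a dvd m}"

definition CF2 :: "nat \<Rightarrow> nat" where
  "CF2 m = m div 2 ^ omega2 m"

text \<open>The divisions on \<^typ>\<open>nat\<close> above and below are exact and the subtraction does not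
  truncate, since \<open>CF2 m\<close> is odd for \<open>m > 0\<close>.\<close>

definition alpha :: "nat \<Rightarrow> nat" where
  "alpha n = (CF2 (n + 1) - 1) div 2"

text \<open>\<open>bit m i\<close> says that the binary digit of \<open>m\<close> at weight \<open>2 ^ i\<close> is 1; only finitely many
  digits of a natural number are 1.\<close>

definition d :: "nat \<Rightarrow> nat" where
  "d m = card {i. bit m i}"

end

theory Submission
  imports Defs
begin

text \<open>Writing \<open>n + 1 = 2 ^ a * (2 * b + 1)\<close>, we have \<open>\<alpha>(n) = b\<close> and so
  \<open>d(n + 1) = d(\<alpha>(n)) + 1\<close>. Hence the set in question corresponds to the \<open>m\<close> with
  \<open>2 \<le> m \<le> 2 ^ t\<close> and \<open>k + 1\<close> binary ones. Trading \<open>m = 2 ^ t\<close> for \<open>m = 1\<close>, which both have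
  a single one, gives the numbers below \<open>2 ^ t\<close> with \<open>k + 1\<close> ones.\<close>

text \<open>A one at position \<open>i\<close> forces \<open>2 ^ i \<le> m\<close>, hence
  \<open>i < m\<close>. Finiteness is what lets \<open>card\<close> count the extra digit in
  \<open>d_double_plus_one\<close>.\<close>

lemma finite_bits_nat: "finite {i. bit (m::nat) i}"
proof (rule finite_subset)
  show "{i. bit m i} \<subseteq> {..<m}"
  proof
    fix i assume "i \<in> {i. bit m i}"
    then have "0 < m div 2 ^ i"
      by (simp add: bit_iff_odd odd_pos)
    then have "2 ^ i \<le> m"
      by (simp add: div_greater_zero_iff)
    then show "i \<in> {..<m}"
      using less_le_trans[OF less_exp] by blast
  qed
qed simp

lemma d_zero: "d 0 = 0"
  by (simp add: d_def)

lemma d_double: "d (2 * m) = d m"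
proof -
  have "{i. bit (2 * m) i} = Suc ` {i. bit m i}"
  proof (rule set_eqI)
    fix i show "i \<in> {i. bit (2 * m) i} \<longleftrightarrow> i \<in> Suc ` {i. bit m i}"
      by (cases i) (auto simp: bit_0 bit_Suc)
  qed
  then show ?thesis
    by (simp add: d_def card_image)
qed

lemma d_double_plus_one: "d (2 * m + 1) = Suc (d m)"
proof -
  have "{i. bit (2 * m + 1) i} = insert 0 (Suc ` {i. bit m i})"
  proof (rule set_eqI)
    fix i show "i \<in> {i. bit (2 * m + 1) i} \<longleftrightarrow> i \<in> insert 0 (Suc ` {i. bit m i})"
      by (cases i) (auto simp: bit_0 bit_Suc)
  qed
  then show ?thesis
    by (simp add: d_def card_image finite_bits_nat)
qed

lemma d_power_of_two_mult: "d (2 ^ a * m) = d m"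
  by (induction a) (simp_all add: d_double mult.assoc)

lemma d_one: "d 1 = 1"
  using d_double_plus_one[of 0] by (simp add: d_zero)

lemma d_power_of_two: "d (2 ^ a) = 1"
  using d_power_of_two_mult[of a 1] d_one by simp

lemma obtain_odd_part:
  fixes m :: nat
  assumes "m > 0"
  obtains a b where "m = 2 ^ a * (2 * b + 1)"
proof -
  have "\<exists>a b. m = 2 ^ a * (2 * b + 1)"
    using assms
  proof (induction m rule: less_induct)
    case (less m)
    show ?case
    proof (cases "even m")
      case True
      then obtain c where c: "m = 2 * c" by blast
      then obtain a b where "c = 2 ^ a * (2 * b + 1)"
        using less.IH[of c] less.prems by auto
      then have "m = 2 ^ Suc a * (2 * b + 1)"
        using c by simp
      then show ?thesis by blast
    next
      case False
      then obtain b where "m = 2 ^ 0 * (2 * b + 1)"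
        by (auto elim: oddE)
      then show ?thesis by blast
    qed
  qed
  then show ?thesis using that by blast
qed

text \<open>A power of two is coprime to the odd factor, so it divides the product only if it
  divides \<open>2 ^ a\<close>; the admissible exponents are exactly \<open>{..a}\<close>.\<close>

lemma omega2_eq: "omega2 (2 ^ a * (2 * b + 1)) = a"
proof -
  have "{i. 2 ^ i dvd 2 ^ a * (2 * b + 1)} = {..a}"
  proof (rule set_eqI)
    fix i
    have "i \<le> a" if "(2::nat) ^ i dvd 2 ^ a * (2 * b + 1)"
    proof -
      have "coprime ((2::nat) ^ i) (2 * b + 1)" by simp
      then have "(2::nat) ^ i dvd 2 ^ a"
        using that coprime_dvd_mult_left_iff by blast
      then show ?thesis
        by (simp add: dvd_power_iff_le)
    qed
    then show "i \<in> {i. 2 ^ i dvd 2 ^ a * (2 * b + 1)} \<longleftrightarrow> i \<in> {..a}"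
      using dvd_mult2[OF le_imp_power_dvd] by blast
  qed
  then show ?thesis
    unfolding omega2_def by (simp add: Max_eq_iff)
qed

lemma d_Suc_eq_d_alpha: "d (Suc n) = Suc (d (alpha n))"
proof -
  obtain a b where ab: "Suc n = 2 ^ a * (2 * b + 1)"
    using obtain_odd_part[of "Suc n"] by blast
  have "alpha n = b"
    using ab omega2_eq[of a b] unfolding alpha_def CF2_def by simp
  then show ?thesis
    using ab d_power_of_two_mult d_double_plus_one by metis
qed

text \<open>Pascal's rule, by splitting on the last binary digit: appending 0 keeps the number of
  ones, appending 1 raises it by one.\<close>

lemma card_d_eq_binomial: "card {m. m < 2 ^ t \<and> d m = j} = t choose j"
proof (induction t arbitrary: j)
  case 0
  have "{m. m < 2 ^ 0 \<and> d m = j} = (if j = 0 then {0} else {})"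
    by (auto simp: d_zero)
  then show ?case by (cases j) simp_all
next
  case (Suc t)
  let ?S = "\<lambda>j. {m. m < 2 ^ t \<and> d m = j}"
  \<comment> \<open>Writing \<open>Suc (d m) = j\<close> instead of \<open>d m = j - 1\<close> makes
    this set empty for \<open>j = 0\<close>, as it must be.\<close>
  let ?odd = "{m. m < 2 ^ t \<and> Suc (d m) = j}"
  have split: "{m. m < 2 ^ Suc t \<and> d m = j} = (\<lambda>m. 2 * m) ` ?S j \<union> (\<lambda>m. 2 * m + 1) ` ?odd"
  proof (rule set_eqI)
    fix m
    show "m \<in> {m. m < 2 ^ Suc t \<and> d m = j} \<longleftrightarrow>
        m \<in> (\<lambda>m. 2 * m) ` ?S j \<union> (\<lambda>m. 2 * m + 1) ` ?odd"
    proof (cases "even m")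
      case True
      then obtain c where "m = 2 * c" by blast
      then show ?thesis
        by (auto simp: d_double) presburger
    next
      case False
      then obtain c where "m = 2 * c + 1" by (blast elim: oddE)
      then show ?thesis
        using d_double_plus_one[of c] by (auto simp: image_iff) presburger+
    qed
  qed
  have "card {m. m < 2 ^ Suc t \<and> d m = j} = card (?S j) + card ?odd"
    unfolding split
  proof (subst card_Un_disjoint)
    show "(\<lambda>m. 2 * m) ` ?S j \<inter> (\<lambda>m. 2 * m + 1) ` ?odd = {}"
      by auto presburger
  qed (simp_all add: card_image inj_on_def)
  also have "\<dots> = Suc t choose j"
    by (cases j) (simp_all add: Suc.IH)
  finally show ?case .
qed

theorem theorem2:
  fixes t k :: nat
  assumes "t \<ge> 1"
  shows "card {n :: nat. n > 0 \<and> n < 2 ^ t \<and> d (alpha n) = k} = t choose (k + 1)"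
proof -
  let ?f = "\<lambda>n::nat. if Suc n = 2 ^ t then 1 else Suc n"
  let ?g = "\<lambda>m::nat. if m = 1 then 2 ^ t - 1 else m - 1"
  let ?A = "{n :: nat. n > 0 \<and> n < 2 ^ t \<and> d (alpha n) = k}"
  let ?B = "{m. m < 2 ^ t \<and> d m = k + 1}"
  \<comment> \<open>This gives \<open>1 < 2 ^ t\<close> and \<open>2 ^ t - 1 > 0\<close>, so the
    exceptional values of \<open>?f\<close> and \<open>?g\<close> lie in the required
    ranges.\<close>
  have t: "(2::nat) \<le> 2 ^ t"
    using power_increasing[OF assms, of "2::nat"] by simp
  have "bij_betw ?f ?A ?B"
  proof (rule bij_betw_byWitness[where f' = ?g])
    show "\<forall>n\<in>?A. ?g (?f n) = n"
      by auto
    show "\<forall>m\<in>?B. ?f (?g m) = m"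
      using t by (auto simp: d_zero Suc_diff_le intro!: Suc_pred gr0I)
    show "?f ` ?A \<subseteq> ?B"
    proof (rule image_subsetI)
      fix n assume "n \<in> ?A"
      then show "?f n \<in> ?B"
        using t d_Suc_eq_d_alpha[of n] d_one d_power_of_two[of t] by auto
    qed
    show "?g ` ?B \<subseteq> ?A"
    proof (rule image_subsetI)
      fix m assume m: "m \<in> ?B"
      \<comment> \<open>Zero has no ones, while \<open>m\<close> has \<open>k + 1\<close>; thus
        \<open>m - 1\<close> does not truncate.\<close>
      then have "m > 0"
        by (auto simp: d_zero intro!: gr0I)
      then have "Suc (?g m) = (if m = 1 then 2 ^ t else m)"
        by auto
      \<comment> \<open>In the exceptional case \<open>m = 1\<close> the successor of
        \<open>?g m\<close> is \<open>2 ^ t\<close>, which has a single one just as \<open>m\<close>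
        does.\<close>
      then have "d (alpha (?g m)) = k"
        using m d_Suc_eq_d_alpha[of "?g m"] d_one d_power_of_two[of t] by (auto split: if_splits)
      then show "?g m \<in> ?A"
        using m t \<open>m > 0\<close> by auto
    qed
  qed
  then show ?thesis
    using card_d_eq_binomial by (simp add: bij_betw_same_card)
qed

end
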